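(* Let $\theta:\mathbb{R}^m\to\,]-\infty,\infty]$ be a CPWL function, let $\bar z\in\operatorname{dom}\theta$ with $0\in\operatorname{aff}\partial\theta(\bar z)$, let $S(\bar z)$ be the linear subspace of $\mathbb{R}^m$ parallel to $\operatorname{aff}\partial\theta(\bar z)$ (so $S(\bar z)=\operatorname{aff}\partial\theta(\bar z)$), and let $s:=\dim S(\bar z)\le m$. Then $\theta$ is $\mathcal{C}^\infty$-reducible at $\bar z$ to a CPWL function $\vartheta:\mathbb{R}^s\to\,]-\infty,\infty]$ via a linear operator $h(z):=Bz$ generated by some $s\times m$ matrix $B$.
   Context: CPWL: a function $\theta:\mathbb{R}^m\to\,]-\infty,\infty]$ is convex piecewise linear (CPWL) if $\operatorname{dom}\theta=\{z:\theta(z)<\infty\}$ is nonempty and $\operatorname{epi}\theta$ is a convex polyhedron (equivalently, $\operatorname{dom}\theta$ is a nonempty convex polyhedron on which $\theta$ is the maximum of finitely many affine functions). $\partial\theta$ is the subdifferential of convex analysis and $\operatorname{aff}$ denotes affine hull. Reducibility: $\theta:\mathbb{R}^m\to\,]-\infty,\infty]$ is $\mathcal{C}^\infty$-reducible at $\bar z$ to $\vartheta:\mathbb{R}^s\to\,]-\infty,\infty]$, $s\le m$, via $h$ if $h:\mathbb{R}^m\to\mathbb{R}^s$ is a $\mathcal{C}^\infty$-smooth mapping with surjective derivative $\nabla h(\bar z)$ such that $\theta(z)=\vartheta(h(z))$ for all $z$ in a neighborhood of $\bar z$. *)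

theory Defs
  imports "HOL-Analysis.Analysis"
begin

definition edom :: "('a \<Rightarrow> ereal) \<Rightarrow> 'a set" where
  "edom \<theta> = {z. \<theta> z < \<infinity>}"

definition cpwl :: "('a::euclidean_space \<Rightarrow> ereal) \<Rightarrow> bool" where
  "cpwl \<theta> \<longleftrightarrow> (\<forall>z. \<theta> z \<noteq> -\<infinity>) \<and> edom \<theta> \<noteq> {} \<and> polyhedron {(z, t::real). \<theta> z \<le> ereal t}"

text \<open>The convention \<open>\<partial>\<theta>(z) = \<emptyset>\<close> outside of the domain is the usual one.\<close>

definition subdifferential :: "('a::euclidean_space \<Rightarrow> ereal) \<Rightarrow> 'a \<Rightarrow> 'a set" where
  "subdifferential \<theta> z =
     {v. \<bar>\<theta> z\<bar> \<noteq> \<infinity> \<and> (\<forall>x. \<theta> z + ereal (v \<bullet> (x - z)) \<le> \<theta> x)}"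

text \<open>The dimension \<open>s\<close> of the target space depends on the data and may be \<open>0\<close>, so it cannot be
  a type. The space with coordinates indexed by a finite set \<open>I\<close> is therefore given by
  an explicit carrier (functions that are \<open>undefined\<close> off \<open>I\<close>), and
  \<open>\<real>\<^sup>s\<close> is \<open>coord_space {..<s}\<close>.\<close>

definition coord_space :: "'i set \<Rightarrow> ('i \<Rightarrow> real) set" where
  "coord_space I = I \<rightarrow>\<^sub>E UNIV"

text \<open>Solution sets, in the product of \<open>coord_space I\<close> with the real line, of finitely many linear
  inequalities \<open>\<langle>a, y\<rangle> + b t \<le> c\<close>.\<close>

definition coord_polyhedron :: "'i set \<Rightarrow> (('i \<Rightarrow> real) \<times> real) set \<Rightarrow> bool" where
  "coord_polyhedron I P \<longleftrightarrow>
     (\<exists>F :: (('i \<Rightarrow> real) \<times> real \<times> real) set. finite F \<and>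
        P = {(y, t). y \<in> coord_space I \<and> (\<forall>(a, b, c)\<in>F. (\<Sum>i\<in>I. a i * y i) + b * t \<le> c)})"

text \<open>The counterpart of \<^const>\<open>cpwl\<close>; values of \<open>\<theta>\<close> outside of the carrier are irrelevant.\<close>

definition coord_cpwl :: "'i set \<Rightarrow> (('i \<Rightarrow> real) \<Rightarrow> ereal) \<Rightarrow> bool" where
  "coord_cpwl I \<theta> \<longleftrightarrow>
     (\<forall>y\<in>coord_space I. \<theta> y \<noteq> -\<infinity>) \<and>
     coord_space I \<inter> edom \<theta> \<noteq> {} \<and>
     coord_polyhedron I {(y, t::real). y \<in> coord_space I \<and> \<theta> y \<le> ereal t}"

lemma coord_polyhedron_UNIV:
  fixes P :: "((real^'m) \<times> real) set"
  assumes "P \<noteq> {}"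
  shows "coord_polyhedron UNIV ((\<lambda>(x, t). (vec_nth x, t)) ` P) \<longleftrightarrow> polyhedron P"
proof
  let ?g = "\<lambda>(x :: real^'m, t :: real). (vec_nth x, t)"
  have inj: "inj ?g"
    by (auto simp: inj_on_def vec_nth_inject)
  assume "coord_polyhedron UNIV (?g ` P)"
  then obtain F :: "(('m \<Rightarrow> real) \<times> real \<times> real) set" where F: "finite F"
    and eq: "?g ` P = {(y, t). \<forall>(a, b, c)\<in>F. (\<Sum>i\<in>UNIV. a i * y i) + b * t \<le> c}"
    unfolding coord_polyhedron_def by (auto simp: coord_space_def)
  let ?H = "\<lambda>(a, b, c). {p :: (real^'m) \<times> real. (vec_lambda a, b) \<bullet> p \<le> c}"
  have "p \<in> P \<longleftrightarrow> p \<in> \<Inter> (?H ` F)" for p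
  proof -
    have "p \<in> P \<longleftrightarrow> ?g p \<in> ?g ` P"
      using inj by (metis inj_image_mem_iff)
    also have "\<dots> \<longleftrightarrow> p \<in> \<Inter> (?H ` F)"
      unfolding eq by (cases p) (auto simp: inner_vec_def inner_prod_def)
    finally show ?thesis .
  qed
  then have "P = \<Inter> (?H ` F)" by blast
  moreover have "polyhedron (\<Inter> (?H ` F))"
    using F by (intro polyhedron_Inter) (auto intro: polyhedron_halfspace_le)
  ultimately show "polyhedron P" by simp
next
  let ?g = "\<lambda>(x :: real^'m, t :: real). (vec_nth x, t)"
  assume "polyhedron P"
  then obtain H where H: "finite H" "P = \<Inter>H" "\<forall>h\<in>H. \<exists>a b. a \<noteq> 0 \<and> h = {x. a \<bullet> x \<le> b}"
    unfolding polyhedron_def by blast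
  then obtain a b where ab: "\<And>h. h \<in> H \<Longrightarrow> h = {x. a h \<bullet> x \<le> b h}"
    by metis
  let ?F = "(\<lambda>h. (vec_nth (fst (a h)), snd (a h), b h)) ` H"
  have "?g ` P = {(y, t). \<forall>(a, b, c)\<in>?F. (\<Sum>i\<in>UNIV. a i * y i) + b * t \<le> c}"
  proof (intro set_eqI)
    fix q :: "('m \<Rightarrow> real) \<times> real"
    obtain y t where q: "q = (y, t)" by (cases q)
    have "q \<in> ?g ` P \<longleftrightarrow> (vec_lambda y, t) \<in> P"
      unfolding q by (force simp: image_iff vec_lambda_eta)
    also have "\<dots> \<longleftrightarrow> (\<forall>h\<in>H. a h \<bullet> (vec_lambda y, t) \<le> b h)"
      using H(2) ab by blast
    also have "\<dots> \<longleftrightarrow> q \<in> {(y, t). \<forall>(a, b, c)\<in>?F. (\<Sum>i\<in>UNIV. a i * y i) + b * t \<le> c}"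
      by (simp add: q inner_prod_def inner_vec_def)
    finally show "q \<in> ?g ` P \<longleftrightarrow> \<dots>" .
  qed
  then show "coord_polyhedron UNIV (?g ` P)"
    unfolding coord_polyhedron_def coord_space_def using H(1)
    by (intro exI[of _ ?F]) auto
qed

lemma coord_cpwl_UNIV:
  fixes \<theta> :: "real^'m \<Rightarrow> ereal"
  shows "coord_cpwl UNIV (\<lambda>y. \<theta> (vec_lambda y)) \<longleftrightarrow> cpwl \<theta>"
proof -
  let ?E = "{(z, t::real). \<theta> z \<le> ereal t}"
  have img: "{(y, t::real). y \<in> coord_space UNIV \<and> \<theta> (vec_lambda y) \<le> ereal t} =
      (\<lambda>(x, t). (vec_nth x, t)) ` ?E"
    by (force simp: coord_space_def image_iff vec_lambda_eta)
  have all: "(\<forall>y. Q (vec_lambda y)) \<longleftrightarrow> (\<forall>z. Q z)" for Q :: "real^'m \<Rightarrow> bool"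
    by (metis vec_lambda_eta)
  have ex: "edom (\<lambda>y. \<theta> (vec_lambda y)) \<noteq> {} \<longleftrightarrow> edom \<theta> \<noteq> {}"
    using all[of "\<lambda>z. \<not> \<theta> z < \<infinity>"] by (auto simp: edom_def)
  have "?E \<noteq> {}" if ne: "edom \<theta> \<noteq> {}"
  proof -
    from ne obtain z where "\<theta> z < \<infinity>" by (auto simp: edom_def)
    then obtain t where "\<theta> z \<le> ereal t"
      by (cases "\<theta> z") auto
    then show ?thesis by auto
  qed
  then show ?thesis
    unfolding coord_cpwl_def cpwl_def img
    using ex coord_polyhedron_UNIV[of ?E] all[of "\<lambda>z. \<theta> z \<noteq> -\<infinity>"]
    by (auto simp: coord_space_def)
qed

primrec Ck :: "nat \<Rightarrow> ('a::euclidean_space \<Rightarrow> real) \<Rightarrow> bool" where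
  "Ck 0 f \<longleftrightarrow> continuous_on UNIV f"
| "Ck (Suc k) f \<longleftrightarrow> f differentiable_on UNIV \<and>
     (\<forall>b\<in>Basis. Ck k (\<lambda>x. frechet_derivative f (at x) b))"

definition Cinf :: "('a::euclidean_space \<Rightarrow> real) \<Rightarrow> bool" where
  "Cinf f \<longleftrightarrow> (\<forall>k. Ck k f)"

text \<open>Smoothness and the derivative of a map into \<open>\<real>\<^sup>s\<close> are taken componentwise;
  the equation of sets says that the derivative of \<open>h\<close> at \<open>z\<close> is surjective.\<close>

definition Cinf_reducible ::
  "(real^'m \<Rightarrow> ereal) \<Rightarrow> real^'m \<Rightarrow> nat \<Rightarrow> ((nat \<Rightarrow> real) \<Rightarrow> ereal) \<Rightarrow>
     (real^'m \<Rightarrow> nat \<Rightarrow> real) \<Rightarrow> bool" where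
  "Cinf_reducible \<theta> z s \<phi> h \<longleftrightarrow>
     s \<le> CARD('m) \<and>
     (\<forall>x. \<theta> x \<noteq> -\<infinity>) \<and> (\<forall>y\<in>coord_space {..<s}. \<phi> y \<noteq> -\<infinity>) \<and>
     h \<in> UNIV \<rightarrow> coord_space {..<s} \<and>
     (\<forall>i<s. Cinf (\<lambda>x. h x i)) \<and>
     (\<lambda>v. \<lambda>i\<in>{..<s}. frechet_derivative (\<lambda>x. h x i) (at z) v) ` UNIV = coord_space {..<s} \<and>
     (\<forall>\<^sub>F x in nhds z. \<theta> x = \<phi> (h x))"

definition mat_op :: "nat \<Rightarrow> (nat \<Rightarrow> 'm \<Rightarrow> real) \<Rightarrow> real^'m \<Rightarrow> nat \<Rightarrow> real" where
  "mat_op s B z = (\<lambda>i\<in>{..<s}. \<Sum>j\<in>UNIV. B i j * z $ j)"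

end

theory Submission
  imports Defs
begin

text \<open>Near \<open>(zbar, \<theta> zbar)\<close> the epigraph of \<open>\<theta>\<close> is cut out by the inequalities
  \<open>\<langle>a, z\<rangle> + b t \<le> c\<close> that are active there, and all of them have \<open>b \<le> 0\<close>. If \<open>b < 0\<close> then
  \<open>a / \<bar>b\<bar>\<close> is a subgradient at \<open>zbar\<close>; if \<open>b = 0\<close> then \<open>a\<close> can be added to any subgradient. In both
  cases \<open>a \<in> S\<close>, so near \<open>zbar\<close> the function \<open>\<theta>\<close> depends only on the orthogonal projection of
  its argument to \<open>S\<close>, that is, on the coordinates with respect to an orthonormal basis of \<open>S\<close>.
  These are the rows of \<open>B\<close>.\<close>

section \<open>Halfspaces active at a point of the epigraph\<close>

lemma polyhedron_prod_real_halfspaces: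
  fixes P :: "('a::euclidean_space \<times> real) set"
  assumes "polyhedron P"
  obtains F :: "('a \<times> real \<times> real) set" where "finite F"
    and "\<And>z t. (z, t) \<in> P \<longleftrightarrow> (\<forall>(a, b, c)\<in>F. a \<bullet> z + b * t \<le> c)"
proof -
  obtain H where H: "finite H" "P = \<Inter>H" "\<forall>h\<in>H. \<exists>a b. a \<noteq> 0 \<and> h = {x. a \<bullet> x \<le> b}"
    using assms unfolding polyhedron_def by blast
  then obtain a b where ab: "\<And>h. h \<in> H \<Longrightarrow> h = {x. a h \<bullet> x \<le> b h}"
    by metis
  show thesis
  proof (rule that[of "(\<lambda>h. (fst (a h), snd (a h), b h)) ` H"])
    show "finite ((\<lambda>h. (fst (a h), snd (a h), b h)) ` H)"
      using H(1) by simp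
    fix z t
    have "(z, t) \<in> P \<longleftrightarrow> (\<forall>h\<in>H. a h \<bullet> (z, t) \<le> b h)"
      using H(2) ab by blast
    then show "(z, t) \<in> P \<longleftrightarrow>
        (\<forall>(a, b, c)\<in>(\<lambda>h. (fst (a h), snd (a h), b h)) ` H. a \<bullet> z + b * t \<le> c)"
      by (simp add: inner_prod_def)
  qed
qed

text \<open>Inactive inequalities are strict at \<open>(z, \<tau>)\<close>, hence hold nearby by
  continuity. The local description still covers every \<open>t\<close>: an active inequality with
  \<open>b < 0\<close> bounds \<open>t\<close> from below by an affine function of \<open>x\<close>,
  and raising \<open>t\<close> preserves inequalities with \<open>b \<le> 0\<close>.\<close>

lemma cpwl_active_halfspaces:
  fixes \<theta> :: "'a::euclidean_space \<Rightarrow> ereal"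
  assumes "cpwl \<theta>" and val: "\<theta> z = ereal \<tau>"
  obtains A :: "('a \<times> real \<times> real) set" where "finite A"
    and "\<And>a b c. (a, b, c) \<in> A \<Longrightarrow> b \<le> 0 \<and> a \<bullet> z + b * \<tau> = c"
    and "\<And>a b c x t. (a, b, c) \<in> A \<Longrightarrow> \<theta> x \<le> ereal t \<Longrightarrow> a \<bullet> x + b * t \<le> c"
    and "\<exists>(a, b, c)\<in>A. b < 0"
    and "\<forall>\<^sub>F x in nhds z. \<forall>t. \<theta> x \<le> ereal t \<longleftrightarrow> (\<forall>(a, b, c)\<in>A. a \<bullet> x + b * t \<le> c)"
proof -
  have "polyhedron {(z, t::real). \<theta> z \<le> ereal t}"
    using assms(1) by (simp add: cpwl_def)
  then obtain F where fin: "finite F"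
    and F: "\<And>x t. \<theta> x \<le> ereal t \<longleftrightarrow> (\<forall>(a, b, c)\<in>F. a \<bullet> x + b * t \<le> c)"
    by (rule polyhedron_prod_real_halfspaces) auto
  have nonpos: "b \<le> 0" if "(a, b, c) \<in> F" for a b c
  proof (rule ccontr)
    assume "\<not> b \<le> 0"
    \<comment> \<open>\<open>t \<ge> \<tau>\<close> keeps \<open>(z, t)\<close> in the epigraph,
      while the second bound makes the left side at least \<open>c + b > c\<close>.\<close>
    define t where "t = max \<tau> ((c - a \<bullet> z) / b + 1)"
    have "\<theta> z \<le> ereal t"
      by (simp add: val t_def)
    then have "a \<bullet> z + b * t \<le> c"
      using F that by blast
    moreover have "b * ((c - a \<bullet> z) / b + 1) \<le> b * t"
      using \<open>\<not> b \<le> 0\<close> by (intro mult_left_mono) (auto simp: t_def)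
    moreover have "b * ((c - a \<bullet> z) / b + 1) = c - a \<bullet> z + b"
      using \<open>\<not> b \<le> 0\<close> by (simp add: distrib_left)
    ultimately show False
      using \<open>\<not> b \<le> 0\<close> by simp
  qed
  define A where "A = {(a, b, c). (a, b, c) \<in> F \<and> a \<bullet> z + b * \<tau> = c}"
  have strict: "a \<bullet> z + b * \<tau> < c" if "(a, b, c) \<in> F - A" for a b c
    using that F[of z \<tau>] by (force simp: A_def val)
  have neg: "\<exists>(a, b, c)\<in>A. b < 0"
  proof (rule ccontr)
    \<comment> \<open>With only vertical active inequalities, \<open>t\<close> could drop slightly
      below \<open>\<tau> = \<theta> z\<close> without leaving the epigraph.\<close>
    assume no: "\<not> ?thesis"
    have "\<forall>\<^sub>F t in at_left \<tau>. \<forall>p\<in>F. fst p \<bullet> z + fst (snd p) * t \<le> snd (snd p)"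
    proof (rule eventually_ball_finite[OF fin], rule ballI)
      fix p assume "p \<in> F"
      obtain a b c where p: "p = (a, b, c)" by (cases p)
      show "\<forall>\<^sub>F t in at_left \<tau>. fst p \<bullet> z + fst (snd p) * t \<le> snd (snd p)"
      proof (cases "p \<in> A")
        case True
        then have "b = 0"
          using no nonpos \<open>p \<in> F\<close> by (force simp: p)
        then show ?thesis
          using True by (simp add: p A_def)
      next
        case False
        have "((\<lambda>t. a \<bullet> z + b * t) \<longlongrightarrow> a \<bullet> z + b * \<tau>) (at_left \<tau>)"
          by (intro tendsto_intros)
        then have "\<forall>\<^sub>F t in at_left \<tau>. a \<bullet> z + b * t < c"
          using strict False \<open>p \<in> F\<close> by (intro order_tendstoD(2)) (auto simp: p)
        then show ?thesis
          by eventually_elim (simp add: p)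
      qed
    qed
    moreover have "\<forall>\<^sub>F t in at_left \<tau>. t < \<tau>"
      by (simp add: eventually_at_filter)
    ultimately have "\<forall>\<^sub>F t in at_left \<tau>. False"
    proof eventually_elim
      case (elim t)
      then have "\<theta> z \<le> ereal t" using F by auto
      then show ?case using elim val by simp
    qed
    then show False by simp
  qed
  then obtain a0 b0 c0 where abc0: "(a0, b0, c0) \<in> A" "b0 < 0" by auto
  \<comment> \<open>The active inequality \<open>(a0, b0, c0)\<close> reads \<open>l x \<le> t\<close>, and \<open>l z = \<tau>\<close>.\<close>
  define l where "l x = (c0 - a0 \<bullet> x) / b0" for x
  have lz: "l z = \<tau>"
    using abc0 by (auto simp: l_def A_def field_simps)
  \<comment> \<open>The inactive inequalities are tested on the graph of \<open>l\<close>, the lower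
    bound for \<open>t\<close>; at \<open>x = z\<close> this is the point
    \<open>(z, \<tau>)\<close>.\<close>
  have "\<forall>\<^sub>F x in nhds z. \<forall>p\<in>F - A. fst p \<bullet> x + fst (snd p) * l x < snd (snd p)"
  proof (rule eventually_ball_finite, use fin in simp, rule ballI)
    fix p assume "p \<in> F - A"
    obtain a b c where p: "p = (a, b, c)" by (cases p)
    have "((\<lambda>x. a \<bullet> x + b * l x) \<longlongrightarrow> a \<bullet> z + b * l z) (nhds z)"
      unfolding l_def using abc0(2) by (intro tendsto_intros filterlim_ident) auto
    then show "\<forall>\<^sub>F x in nhds z. fst p \<bullet> x + fst (snd p) * l x < snd (snd p)"
      using strict \<open>p \<in> F - A\<close> by (intro order_tendstoD(2)) (auto simp: p lz)
  qed
  then have "\<forall>\<^sub>F x in nhds z. \<forall>t. \<theta> x \<le> ereal t \<longleftrightarrow> (\<forall>(a, b, c)\<in>A. a \<bullet> x + b * t \<le> c)"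
  proof eventually_elim
    case (elim x)
    have "a \<bullet> x + b * t \<le> c"
      if act: "\<forall>(a, b, c)\<in>A. a \<bullet> x + b * t \<le> c" and "(a, b, c) \<in> F" for t a b c
    proof (cases "(a, b, c) \<in> A")
      case False
      have "l x \<le> t"
        using abc0 act by (force simp: l_def field_simps)
      then have "b * t \<le> b * l x"
        using nonpos that(2) by (intro mult_left_mono_neg) auto
      then show ?thesis
        using elim that(2) False by force
    qed (use act in auto)
    then show ?case
      unfolding F by (fastforce simp: A_def)
  qed
  moreover have "finite A"
    using fin by (rule finite_subset[rotated]) (auto simp: A_def)
  ultimately show thesis
    using nonpos F neg by (intro that[of A]) (auto simp: A_def)
qed

section \<open>Normals of active halfspaces and subgradients\<close>

text \<open>A finite \<open>\<theta> x\<close> is itself an admissible \<open>t\<close>, and an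
  infinite one makes the subgradient inequality trivial.\<close>

lemma subdifferential_epigraph:
  assumes "\<theta> z = ereal \<tau>" and "\<And>x. \<theta> x \<noteq> -\<infinity>"
    and "\<And>x t. \<theta> x \<le> ereal t \<Longrightarrow> \<tau> + v \<bullet> (x - z) \<le> t"
  shows "v \<in> subdifferential \<theta> z"
proof -
  have "\<theta> z + ereal (v \<bullet> (x - z)) \<le> \<theta> x" for x
    using assms(1) assms(2)[of x] assms(3)[of x] by (cases "\<theta> x") auto
  then show ?thesis
    using assms(1) by (simp add: subdifferential_def)
qed

lemma active_normal_in_subspace:
  fixes \<theta> :: "'a::euclidean_space \<Rightarrow> ereal"
  assumes val: "\<theta> z = ereal \<tau>" and proper: "\<And>x. \<theta> x \<noteq> -\<infinity>"
    and S: "subspace S" "subdifferential \<theta> z \<subseteq> S"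
    and act: "\<And>a b c. (a, b, c) \<in> A \<Longrightarrow> b \<le> 0 \<and> a \<bullet> z + b * \<tau> = c"
    and valid: "\<And>a b c x t. (a, b, c) \<in> A \<Longrightarrow> \<theta> x \<le> ereal t \<Longrightarrow> a \<bullet> x + b * t \<le> c"
    and neg: "\<exists>(a, b, c)\<in>A. b < 0"
    and mem: "(a, b, c) \<in> A"
  shows "a \<in> S"
proof -
  \<comment> \<open>Dividing the active inequality by \<open>- b > 0\<close> yields an affine
    minorant that is exact at \<open>z\<close> and has this slope.\<close>
  have grad: "(- 1 / b) *\<^sub>R a \<in> subdifferential \<theta> z" if "(a, b, c) \<in> A" "b < 0" for a b c
  proof (rule subdifferential_epigraph[where \<theta> = \<theta>, OF val proper])
    fix x t assume "\<theta> x \<le> ereal t"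
    then have "a \<bullet> x + b * t \<le> a \<bullet> z + b * \<tau>"
      using valid act that(1) by metis
    then show "\<tau> + (- 1 / b) *\<^sub>R a \<bullet> (x - z) \<le> t"
      using that(2) by (simp add: inner_diff_right field_simps)
  qed
  show ?thesis
  proof (cases "b < 0")
    case True
    then have "(- b) *\<^sub>R ((- 1 / b) *\<^sub>R a) \<in> S"
      using grad[OF mem True] S(2) by (blast intro: subspace_scale[OF S(1)])
    then show ?thesis using True by simp
  next
    case False
    then have "b = 0" using act mem by force
    obtain a0 b0 c0 where "(a0, b0, c0) \<in> A" "b0 < 0" using neg by auto
    then obtain v where v: "v \<in> subdifferential \<theta> z" using grad by blast
    \<comment> \<open>With \<open>b = 0\<close>, \<open>a\<close> is normal to the domain at
      \<open>z\<close>: \<open>a \<bullet> (x - z) \<le> 0\<close> for \<open>x\<close> in the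
      domain, so adding \<open>a\<close> preserves the subgradient inequality.\<close>
    have "v + a \<in> subdifferential \<theta> z"
    proof (rule subdifferential_epigraph[where \<theta> = \<theta>, OF val proper])
      fix x t assume le: "\<theta> x \<le> ereal t"
      have "a \<bullet> x \<le> a \<bullet> z"
        using valid[OF mem le] act[OF mem] \<open>b = 0\<close> by simp
      moreover have "ereal (\<tau> + v \<bullet> (x - z)) \<le> \<theta> x"
        using v val by (simp add: subdifferential_def)
      then have "\<tau> + v \<bullet> (x - z) \<le> t"
        using le by (metis ereal_less_eq(3) order_trans)
      ultimately show "\<tau> + (v + a) \<bullet> (x - z) \<le> t"
        by (simp add: inner_diff_right inner_add_left)
    qed
    then have "(v + a) - v \<in> S"
      using v S by (intro subspace_diff) auto
    then show ?thesis by simp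
  qed
qed

section \<open>Smoothness of linear maps\<close>

lemma Ck_const: "Ck k (\<lambda>x::'a::euclidean_space. c)"
  by (induction k arbitrary: c) (auto simp: frechet_derivative_const)

text \<open>The directional derivatives of a linear map are constant, so one unfolding of
  \<open>Ck\<close> leads to constants.\<close>

lemma Cinf_linear:
  fixes f :: "'a::euclidean_space \<Rightarrow> real"
  assumes "linear f"
  shows "Cinf f"
proof -
  have "frechet_derivative f (at x) = f" for x
    using linear_imp_has_derivative[OF assms] by (metis frechet_derivative_at)
  moreover have "continuous_on UNIV f"
    using assms by (simp add: linear_continuous_on linear_conv_bounded_linear)
  moreover have "f differentiable_on UNIV"
    using linear_imp_differentiable[OF assms] by (simp add: differentiable_on_def)
  ultimately have "Ck k f" for k
    by (cases k) (auto simp: Ck_const)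
  then show ?thesis by (simp add: Cinf_def)
qed

section \<open>Functions defined by halfspaces\<close>

text \<open>Meaningful only if all \<open>b \<le> 0\<close>; the case \<open>b = 0\<close> is a vertical halfspace.\<close>

definition halfspace_fun :: "('a::euclidean_space \<times> real \<times> real) set \<Rightarrow> 'a \<Rightarrow> ereal" where
  "halfspace_fun A z = (SUP (a, b, c)\<in>A. if b < 0 then ereal ((c - a \<bullet> z) / b)
     else if a \<bullet> z \<le> c then -\<infinity> else \<infinity>)"

text \<open>For \<open>b < 0\<close>, division by \<open>b\<close> gives a lower bound on
  \<open>t\<close>. For \<open>b = 0\<close>, the value \<open>-\<infinity>\<close> imposes no bound
  on \<open>t\<close> and \<open>\<infinity>\<close> excludes \<open>z\<close>.\<close>

lemma halfspace_fun_le_iff: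
  assumes "\<And>a b c. (a, b, c) \<in> A \<Longrightarrow> b \<le> 0"
  shows "halfspace_fun A z \<le> ereal t \<longleftrightarrow> (\<forall>(a, b, c)\<in>A. a \<bullet> z + b * t \<le> c)"
proof -
  have "(if b < 0 then ereal ((c - a \<bullet> z) / b) else if a \<bullet> z \<le> c then -\<infinity> else \<infinity>) \<le> ereal t
      \<longleftrightarrow> a \<bullet> z + b * t \<le> c" if "(a, b, c) \<in> A" for a b c
    using assms[OF that] by (cases "b = 0") (auto simp: field_simps)
  then show ?thesis
    unfolding halfspace_fun_def SUP_le_iff by fastforce
qed

lemma halfspace_fun_not_MInf:
  assumes "\<exists>(a, b, c)\<in>A. b < 0"
  shows "halfspace_fun A z \<noteq> -\<infinity>"
proof -
  obtain a b c where abc: "(a, b, c) \<in> A" "b < 0" using assms by auto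
  have "ereal ((c - a \<bullet> z) / b) \<le> halfspace_fun A z"
    unfolding halfspace_fun_def by (rule SUP_upper2[OF abc(1)]) (simp add: abc(2))
  then show ?thesis by auto
qed

text \<open>Allows \<open>z\<close> to be replaced by its projection to a subspace containing all
  normals.\<close>

lemma halfspace_fun_cong:
  assumes "\<And>a b c. (a, b, c) \<in> A \<Longrightarrow> a \<bullet> z = a \<bullet> z'"
  shows "halfspace_fun A z = halfspace_fun A z'"
  unfolding halfspace_fun_def using assms by (intro SUP_cong) auto

text \<open>Passes from equal epigraphs to equal values, infinite ones included.\<close>

lemma ereal_eqI_le_real:
  fixes x y :: ereal
  assumes "\<And>t. x \<le> ereal t \<longleftrightarrow> y \<le> ereal t"
  shows "x = y"
  using assms by (meson antisym ereal_le_real)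

section \<open>Orthonormal coordinates on a subspace\<close>

lemma subspace_indexed_orthonormal_basis:
  fixes S :: "'a::euclidean_space set"
  assumes "subspace S"
  obtains e :: "nat \<Rightarrow> 'a"
    where "\<And>i j. i < dim S \<Longrightarrow> j < dim S \<Longrightarrow> e i \<bullet> e j = (if i = j then 1 else 0)"
      and "\<And>x. x \<in> S \<Longrightarrow> x = (\<Sum>i<dim S. (x \<bullet> e i) *\<^sub>R e i)"
proof -
  obtain C where C: "pairwise orthogonal C" "\<And>x. x \<in> C \<Longrightarrow> norm x = 1"
      "independent C" "card C = dim S" "span C = S"
    using orthonormal_basis_subspace[OF assms] by metis
  have "finite C" using C(3) by (rule finiteI_independent)
  then obtain e where e: "bij_betw e {..<dim S} C"
    using C(4) ex_bij_betw_nat_finite[of C] by (auto simp: atLeast0LessThan)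
  have orth: "e i \<bullet> e j = (if i = j then 1 else 0)" if "i < dim S" "j < dim S" for i j
  proof -
    have "e i \<in> C" "e j \<in> C" using e that by (auto simp: bij_betw_def)
    moreover have "e i = e j \<longleftrightarrow> i = j"
      using e that by (auto simp: bij_betw_def inj_on_def)
    ultimately show ?thesis
      using C(1,2) by (auto simp: pairwise_def orthogonal_def dot_square_norm)
  qed
  have "x = (\<Sum>i<dim S. (x \<bullet> e i) *\<^sub>R e i)" if "x \<in> S" for x
  proof -
    have "x \<in> range (\<lambda>u. \<Sum>v\<in>C. u v *\<^sub>R v)"
      using that C(5) span_finite[OF \<open>finite C\<close>] by simp
    then obtain u where u: "x = (\<Sum>v\<in>C. u v *\<^sub>R v)"
      by blast
    then have x: "x = (\<Sum>i<dim S. u (e i) *\<^sub>R e i)"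
      by (simp add: sum.reindex_bij_betw[OF e, symmetric])
    \<comment> \<open>Orthonormality identifies the coefficients as inner products.\<close>
    have "x \<bullet> e j = u (e j)" if "j < dim S" for j
      by (subst x) (simp add: inner_sum_left orth that if_distrib cong: if_cong)
    then show ?thesis
      by (subst x) simp
  qed
  then show thesis using that orth by blast
qed

section \<open>Reduction to coordinates on \<open>S\<close>\<close>

theorem lemma3p1:
  fixes \<theta> :: "real^'m \<Rightarrow> ereal" and zbar :: "real^'m"
    and S :: "(real^'m) set" and s :: nat
  assumes "cpwl \<theta>"
    and "zbar \<in> edom \<theta>"
    and "0 \<in> affine hull (subdifferential \<theta> zbar)"
    and "subspace S"
    and "affine_parallel (affine hull (subdifferential \<theta> zbar)) S"
    and "s = dim S"
  shows "S = affine hull (subdifferential \<theta> zbar) \<and> s \<le> CARD('m) \<and>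
    (\<exists>(\<phi> :: (nat \<Rightarrow> real) \<Rightarrow> ereal) (B :: nat \<Rightarrow> 'm \<Rightarrow> real).
       coord_cpwl {..<s} \<phi> \<and> Cinf_reducible \<theta> zbar s \<phi> (mat_op s B))"
proof (intro conjI)
  let ?D = "affine hull (subdifferential \<theta> zbar)"
  \<comment> \<open>An affine set containing 0 is a subspace, and parallel subspaces
    coincide.\<close>
  have "subspace ?D"
    using assms(3) by (simp add: subspace_affine)
  then show S_eq: "S = ?D"
    using assms(4,5) parallel_subspace by blast
  show s_le: "s \<le> CARD('m)"
    using assms(6) dim_subset_UNIV[of S] by simp
  have proper: "\<And>x. \<theta> x \<noteq> -\<infinity>"
    using assms(1) by (simp add: cpwl_def)
  obtain \<tau> where val: "\<theta> zbar = ereal \<tau>"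
    using assms(2) proper[of zbar] by (cases "\<theta> zbar") (auto simp: edom_def)
  obtain A where A: "finite A"
      "\<And>a b c. (a, b, c) \<in> A \<Longrightarrow> b \<le> 0 \<and> a \<bullet> zbar + b * \<tau> = c"
      "\<And>a b c x t. (a, b, c) \<in> A \<Longrightarrow> \<theta> x \<le> ereal t \<Longrightarrow> a \<bullet> x + b * t \<le> c"
      "\<exists>(a, b, c)\<in>A. b < 0"
      "\<forall>\<^sub>F x in nhds zbar. \<forall>t. \<theta> x \<le> ereal t \<longleftrightarrow> (\<forall>(a, b, c)\<in>A. a \<bullet> x + b * t \<le> c)"
    by (rule cpwl_active_halfspaces[OF assms(1) val]) blast
  have normal: "a \<in> S" if "(a, b, c) \<in> A" for a b c
    by (rule active_normal_in_subspace[where \<theta> = \<theta>, OF val proper assms(4) _ A(2,3,4) that])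
      (auto simp: S_eq hull_inc)
  obtain e where orth: "\<And>i j. i < s \<Longrightarrow> j < s \<Longrightarrow> e i \<bullet> e j = (if i = j then 1 else 0)"
    and repr: "\<And>x. x \<in> S \<Longrightarrow> x = (\<Sum>i<s. (x \<bullet> e i) *\<^sub>R e i)"
    using subspace_indexed_orthonormal_basis[OF assms(4)] assms(6) by metis
  define B where "B i j = e i $ j" for i :: nat and j :: 'm
  \<comment> \<open>\<open>comb\<close> is the transpose of \<open>B\<close>, so
    \<open>comb (mat_op s B z)\<close> is the orthogonal projection of \<open>z\<close> to
    \<open>S\<close>.\<close>
  define comb where "comb y = (\<Sum>i<s. y i *\<^sub>R e i)" for y :: "nat \<Rightarrow> real"
  \<comment> \<open>Keeping only the inequalities active at \<open>zbar\<close> makes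
    \<open>\<phi>\<close> globally polyhedral, at the price of matching \<open>\<theta>\<close> only
    near \<open>zbar\<close>.\<close>
  define \<phi> where "\<phi> y = halfspace_fun A (comb y)" for y
  have mat: "mat_op s B z = (\<lambda>i\<in>{..<s}. e i \<bullet> z)" for z
    by (simp add: mat_op_def B_def inner_vec_def)
  have comb_mat: "a \<bullet> comb (mat_op s B z) = a \<bullet> z" if "a \<in> S" for a z
  proof -
    have "a \<bullet> comb (mat_op s B z) = (\<Sum>i<s. (e i \<bullet> z) * (a \<bullet> e i))"
      by (simp add: comb_def mat inner_sum_right)
    also have "\<dots> = (\<Sum>i<s. (a \<bullet> e i) *\<^sub>R e i) \<bullet> z"
      by (simp add: inner_sum_left mult.commute)
    also have "\<dots> = a \<bullet> z"
      using repr[OF that] by simp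
    finally show ?thesis .
  qed
  have \<phi>_mat: "\<phi> (mat_op s B z) = halfspace_fun A z" for z
    unfolding \<phi>_def using normal comb_mat by (intro halfspace_fun_cong) blast
  have le_iff: "halfspace_fun A z \<le> ereal t \<longleftrightarrow> (\<forall>(a, b, c)\<in>A. a \<bullet> z + b * t \<le> c)" for z t
    using A(2) by (intro halfspace_fun_le_iff) blast
  have \<phi>_proper: "\<phi> y \<noteq> -\<infinity>" for y
    using A(4) by (simp add: \<phi>_def halfspace_fun_not_MInf)
  have loc: "\<forall>\<^sub>F x in nhds zbar. \<theta> x = \<phi> (mat_op s B x)"
    using A(5) by eventually_elim (simp add: \<phi>_mat le_iff ereal_eqI_le_real)
  have carrier: "mat_op s B z \<in> coord_space {..<s}" for z
    by (simp add: mat_op_def coord_space_def)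
  have "coord_cpwl {..<s} \<phi>"
    unfolding coord_cpwl_def
  proof (intro conjI ballI)
    have "\<phi> (mat_op s B zbar) = ereal \<tau>"
      using eventually_nhds_x_imp_x[OF loc] val by simp
    then show "coord_space {..<s} \<inter> edom \<phi> \<noteq> {}"
      using carrier[of zbar] by (auto simp: edom_def)
    \<comment> \<open>\<open>comb\<close> is linear, so each normal \<open>a\<close> pulls back to
      its coordinates \<open>a \<bullet> e i\<close>.\<close>
    let ?F = "(\<lambda>(a, b, c). (\<lambda>i. a \<bullet> e i, b, c)) ` A"
    have "\<phi> y \<le> ereal t \<longleftrightarrow> (\<forall>(a, b, c)\<in>?F. (\<Sum>i<s. a i * y i) + b * t \<le> c)" for y t
      by (simp add: \<phi>_def le_iff comb_def inner_sum_right split_beta mult.commute)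
    then show "coord_polyhedron {..<s} {(y, t). y \<in> coord_space {..<s} \<and> \<phi> y \<le> ereal t}"
      unfolding coord_polyhedron_def using A(1) by (intro exI[of _ ?F]) auto
  qed (rule \<phi>_proper)
  moreover have "Cinf_reducible \<theta> zbar s \<phi> (mat_op s B)"
    unfolding Cinf_reducible_def
  proof (intro conjI allI ballI impI)
    have lin: "linear (\<lambda>x. mat_op s B x i)" if "i < s" for i
      using that by (simp add: mat linear_iff inner_add_right)
    then show "Cinf (\<lambda>x. mat_op s B x i)" if "i < s" for i
      using that by (intro Cinf_linear)
    \<comment> \<open>A linear map is its own derivative, so it remains to show that
      \<open>mat_op s B\<close> maps onto the carrier.\<close>
    have "frechet_derivative (\<lambda>x. mat_op s B x i) (at zbar) v = mat_op s B v i" if "i < s" for i v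
      using lin[OF that]
      by (metis linear_imp_has_derivative frechet_derivative_at)
    then have deriv: "(\<lambda>v. \<lambda>i\<in>{..<s}. frechet_derivative (\<lambda>x. mat_op s B x i) (at zbar) v) = mat_op s B"
      by (intro ext) (auto simp: restrict_def mat)
    \<comment> \<open>For \<open>i < s\<close> this is orthonormality; for \<open>i \<ge> s\<close>
      both sides are \<open>undefined\<close>.\<close>
    have "y = mat_op s B (comb y)" if "y \<in> coord_space {..<s}" for y
    proof
      fix i show "y i = mat_op s B (comb y) i"
        using that by (cases "i < s")
          (auto simp: mat comb_def inner_sum_right orth coord_space_def PiE_def extensional_def
            if_distrib cong: if_cong)
    qed
    then show "(\<lambda>v. \<lambda>i\<in>{..<s}. frechet_derivative (\<lambda>x. mat_op s B x i) (at zbar) v) ` UNIV =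
        coord_space {..<s}"
      unfolding deriv using carrier by blast
  qed (use s_le proper \<phi>_proper carrier loc in auto)
  ultimately show "\<exists>(\<phi> :: (nat \<Rightarrow> real) \<Rightarrow> ereal) (B :: nat \<Rightarrow> 'm \<Rightarrow> real).
       coord_cpwl {..<s} \<phi> \<and> Cinf_reducible \<theta> zbar s \<phi> (mat_op s B)"
    by blast
qed

end
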